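(* Consider the log-linearized general equilibrium system described in the context, with $\sigma_R\neq0$ and $\sigma_X,\sigma_E$ not both zero. If $\hat s>0$, then the solution of the system has $\hat X<0$.
   Context: Initial equilibrium. The following level values are positive reals: capital uses $K_X,K_R,K_F$ with $\bar K=K_X+K_R+K_F$; a fixed factor $\bar Q$; quantities $X$ (final good), $E$ (energy), $R$ (renewable energy), $F$ (fossil energy, $F=K_F$); prices $P_X=1,P_E,P_R,P_F,P_K,P_Q$; an ad valorem capital tax $t$ and a per-unit offset payment $s$. They satisfy the zero-profit conditions $P_XX=(1+t)P_KK_X+P_EE$, $P_EE=P_FF+P_RR$, $(P_R+s)R=(1+t)P_KK_R+P_Q\bar Q$, $P_FF=(1+t)P_KK_F$, and the balanced government budget $tP_K\bar K=sR$. Share parameters: $\alpha_i=K_i/\bar K$ for $i\in\{X,R,F\}$; $\theta_{XK}=\frac{(1+t)P_KK_X}{P_XX}$, $\theta_{XE}=\frac{P_EE}{P_XX}$, $\theta_{EF}=\frac{P_FF}{P_EE}$, $\theta_{ER}=\frac{P_RR}{P_EE}$, $\theta_{RK}=\frac{(1+t)P_KK_R}{(P_R+s)R}$, $\theta_{RQ}=\frac{P_Q\bar Q}{(P_R+s)R}$, $\gamma=\frac{s}{P_R+s}$, $\psi=\frac{1+t}{t}$. Elasticities of substitution $\sigma_X,\sigma_E,\sigma_R\ge 0$ are given parameters. Log-linear system. Hatted variables denote small proportional changes and are the real unknowns of a linear system ($\hat t=dt/(1+t)$, $\hat s=ds/s$). Given exogenous $\hat s$, the 14 unknowns $\hat K_X,\hat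 K_R,\hat K_F,\hat X,\hat E,\hat F,\hat R,\hat P_K,\hat P_X,\hat P_E,\hat P_F,\hat P_R,\hat P_Q,\hat t$ solve the 14 equations: $0=\alpha_X\hat K_X+\alpha_R\hat K_R+\alpha_F\hat K_F$; $\hat X=\theta_{XK}\hat K_X+\theta_{XE}\hat E$; $\hat P_X+\hat X=\theta_{XK}(\hat t+\hat P_K+\hat K_X)+\theta_{XE}(\hat P_E+\hat E)$; $\hat K_X-\hat E=\sigma_X(\hat P_E-\hat t-\hat P_K)$; $\hat E=\theta_{EF}\hat F+\theta_{ER}\hat R$; $\hat P_E+\hat E=\theta_{EF}(\hat P_F+\hat F)+\theta_{ER}(\hat P_R+\hat R)$; $\hat R-\hat F=\sigma_E(\hat P_F-\hat P_R)$; $\hat R=\theta_{RK}\hat K_R$; $(1-\gamma)\hat P_R+\gamma\hat s+\hat R=\theta_{RK}(\hat t+\hat P_K+\hat K_R)+\theta_{RQ}\hat P_Q$; $\hat K_R=\sigma_R(\hat P_Q-\hat t-\hat P_K)$; $\hat F=\hat K_F$; $\hat P_F+\hat F=\hat t+\hat P_K+\hat K_F$; $\hat s+\hat R=\psi\hat t+\hat P_K$; $\hat P_X=0$. *)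

theory Defs
  imports Complex_Main
begin

text \<open>
  Levels at the initial equilibrium. \<open>tax\<close> is the ad valorem capital tax \<open>t\<close>, \<open>offset\<close> the
  per-unit payment \<open>s\<close> to renewable energy.
\<close>

record levels =
  KX :: real
  KR :: real
  KF :: real
  Qbar :: real
  qX :: real
  qE :: real
  qR :: real
  qF :: real
  PX :: real
  PE :: real
  PR :: real
  PF :: real
  PK :: real
  PQ :: real
  tax :: real
  offset :: real

definition Kbar :: "levels \<Rightarrow> real" where
  "Kbar e = KX e + KR e + KF e"

definition positive_levels :: "levels \<Rightarrow> bool" where
  "positive_levels e \<longleftrightarrow>
     KX e > 0 \<and> KR e > 0 \<and> KF e > 0 \<and> Qbar e > 0 \<and>
     qX e > 0 \<and> qE e > 0 \<and> qR e > 0 \<and> qF e > 0 \<and>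
     PX e > 0 \<and> PE e > 0 \<and> PR e > 0 \<and> PF e > 0 \<and> PK e > 0 \<and> PQ e > 0 \<and>
     tax e > 0 \<and> offset e > 0"

definition initial_equilibrium :: "levels \<Rightarrow> bool" where
  "initial_equilibrium e \<longleftrightarrow>
     positive_levels e \<and>
     PX e = 1 \<and>
     qF e = KF e \<and>
     PX e * qX e = (1 + tax e) * PK e * KX e + PE e * qE e \<and>
     PE e * qE e = PF e * qF e + PR e * qR e \<and>
     (PR e + offset e) * qR e = (1 + tax e) * PK e * KR e + PQ e * Qbar e \<and>
     PF e * qF e = (1 + tax e) * PK e * KF e \<and>
     tax e * PK e * Kbar e = offset e * qR e"

definition alpha_X :: "levels \<Rightarrow> real" where "alpha_X e = KX e / Kbar e"
definition alpha_R :: "levels \<Rightarrow> real" where "alpha_R e = KR e / Kbar e"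
definition alpha_F :: "levels \<Rightarrow> real" where "alpha_F e = KF e / Kbar e"

definition theta_XK :: "levels \<Rightarrow> real" where
  "theta_XK e = ((1 + tax e) * PK e * KX e) / (PX e * qX e)"
definition theta_XE :: "levels \<Rightarrow> real" where
  "theta_XE e = (PE e * qE e) / (PX e * qX e)"
definition theta_EF :: "levels \<Rightarrow> real" where
  "theta_EF e = (PF e * qF e) / (PE e * qE e)"
definition theta_ER :: "levels \<Rightarrow> real" where
  "theta_ER e = (PR e * qR e) / (PE e * qE e)"
definition theta_RK :: "levels \<Rightarrow> real" where
  "theta_RK e = ((1 + tax e) * PK e * KR e) / ((PR e + offset e) * qR e)"
definition theta_RQ :: "levels \<Rightarrow> real" where
  "theta_RQ e = (PQ e * Qbar e) / ((PR e + offset e) * qR e)"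

definition gamma_share :: "levels \<Rightarrow> real" where
  "gamma_share e = offset e / (PR e + offset e)"
definition psi_ratio :: "levels \<Rightarrow> real" where
  "psi_ratio e = (1 + tax e) / tax e"

text \<open>
  The unknown proportional changes. All are \<open>dx / x\<close>, except that \<open>ht\<close> is \<open>dt / (1 + t)\<close>.
\<close>

record changes =
  hKX :: real
  hKR :: real
  hKF :: real
  hX :: real
  hE :: real
  hF :: real
  hR :: real
  hPK :: real
  hPX :: real
  hPE :: real
  hPF :: real
  hPR :: real
  hPQ :: real
  ht :: real

definition loglinear_solution ::
  "levels \<Rightarrow> real \<Rightarrow> real \<Rightarrow> real \<Rightarrow> real \<Rightarrow> changes \<Rightarrow> bool" where
  "loglinear_solution e sigma_X sigma_E sigma_R hs h \<longleftrightarrow>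
     0 = alpha_X e * hKX h + alpha_R e * hKR h + alpha_F e * hKF h \<and>
     hX h = theta_XK e * hKX h + theta_XE e * hE h \<and>
     hPX h + hX h = theta_XK e * (ht h + hPK h + hKX h) + theta_XE e * (hPE h + hE h) \<and>
     hKX h - hE h = sigma_X * (hPE h - ht h - hPK h) \<and>
     hE h = theta_EF e * hF h + theta_ER e * hR h \<and>
     hPE h + hE h = theta_EF e * (hPF h + hF h) + theta_ER e * (hPR h + hR h) \<and>
     hR h - hF h = sigma_E * (hPF h - hPR h) \<and>
     hR h = theta_RK e * hKR h \<and>
     (1 - gamma_share e) * hPR h + gamma_share e * hs + hR h
       = theta_RK e * (ht h + hPK h + hKR h) + theta_RQ e * hPQ h \<and>
     hKR h = sigma_R * (hPQ h - ht h - hPK h) \<and>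
     hF h = hKF h \<and>
     hPF h + hF h = ht h + hPK h + hKF h \<and>
     hs + hR h = psi_ratio e * ht h + hPK h \<and>
     hPX h = 0"

end

(*
  Let w be the proportional change of the gross price of capital, w = ht + hPK. The price equations
  express every output price as a multiple of w, the substitution equations then express every
  quantity through w and hKR, capital market clearing gives hKR = mu * w with mu > 0, and zero
  profit in the renewable sector determines w as a positive multiple of hs. If capital earned the
  same value in all sectors, market clearing would make its reallocation output-neutral; but output
  values renewable energy at PR rather than at PR + s, so every unit of capital drawn into that
  sector loses the fraction gamma of its value, and hX is a negative multiple of gamma * hKR.
*)
theory Submission
  imports Defs
begin

locale taxed_economy =
  fixes e :: levels and sigma_X sigma_E sigma_R hs :: real
  assumes equilibrium: "initial_equilibrium e"
    and sigma_X: "sigma_X \<ge> 0" and sigma_E: "sigma_E \<ge> 0" and sigma_R: "sigma_R > 0"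
    and sigma_XE: "\<not> (sigma_X = 0 \<and> sigma_E = 0)"
    and hs: "hs > 0"
begin

section \<open>Signs and adding-up of the initial shares\<close>

lemma levels_pos:
  "KX e > 0" "KR e > 0" "KF e > 0" "Qbar e > 0" "qX e > 0" "qE e > 0" "qR e > 0" "qF e > 0"
  "PX e > 0" "PE e > 0" "PR e > 0" "PF e > 0" "PK e > 0" "PQ e > 0" "tax e > 0" "offset e > 0"
  "Kbar e > 0"
  using equilibrium by (auto simp: initial_equilibrium_def positive_levels_def Kbar_def)

lemma zero_profit:
  "PX e * qX e = (1 + tax e) * PK e * KX e + PE e * qE e"
  "PE e * qE e = PF e * qF e + PR e * qR e"
  "(PR e + offset e) * qR e = (1 + tax e) * PK e * KR e + PQ e * Qbar e"
  "PF e * qF e = (1 + tax e) * PK e * KF e"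
  using equilibrium by (auto simp: initial_equilibrium_def)

lemma shares_pos:
  "alpha_X e > 0" "alpha_R e > 0" "alpha_F e > 0"
  "theta_XK e > 0" "theta_XE e > 0" "theta_EF e > 0" "theta_ER e > 0"
  "theta_RK e > 0" "theta_RQ e > 0" "gamma_share e > 0" "1 - gamma_share e > 0" "psi_ratio e > 1"
  using levels_pos
  by (simp_all add: alpha_X_def alpha_R_def alpha_F_def theta_XK_def theta_XE_def theta_EF_def
      theta_ER_def theta_RK_def theta_RQ_def gamma_share_def psi_ratio_def add_pos_pos)

lemma shares_sum:
  "theta_XK e = 1 - theta_XE e" "theta_ER e = 1 - theta_EF e" "theta_RQ e = 1 - theta_RK e"
proof -
  have "PX e * qX e > 0" "PE e * qE e > 0" "(PR e + offset e) * qR e > 0"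
    using levels_pos by (simp_all add: add_pos_pos)
  then show "theta_XK e = 1 - theta_XE e" "theta_ER e = 1 - theta_EF e"
    "theta_RQ e = 1 - theta_RK e"
    unfolding theta_XK_def theta_XE_def theta_EF_def theta_ER_def theta_RK_def theta_RQ_def
    using zero_profit by (simp_all add: field_simps)
qed

text \<open>Gross cost of the whole capital stock relative to the value of the final good: the
  common factor converting shares of the capital stock into value shares.\<close>

definition capital_share :: real where
  "capital_share = (1 + tax e) * PK e * Kbar e / (PX e * qX e)"

lemma capital_share_pos: "capital_share > 0"
  using levels_pos by (simp add: capital_share_def)

text \<open>Capital has one gross price in all sectors, so its value shares are proportional to the
  \<alpha>'s. Renewable energy enters \<open>theta_ER\<close> at \<open>PR\<close> but
  \<open>theta_RK\<close> at \<open>PR + offset\<close>, whence the factor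
  \<open>1 - gamma_share e\<close>.\<close>

lemma final_good_shares:
  "theta_XK e = capital_share * alpha_X e"
  "theta_XE e * theta_EF e = capital_share * alpha_F e"
  "theta_XE e * theta_ER e * theta_RK e = capital_share * (1 - gamma_share e) * alpha_R e"
proof -
  have pos: "PR e + offset e > 0" using levels_pos by simp
  show "theta_XK e = capital_share * alpha_X e"
    using levels_pos by (simp add: theta_XK_def capital_share_def alpha_X_def)
  show "theta_XE e * theta_EF e = capital_share * alpha_F e"
    using levels_pos zero_profit(4)
    by (simp add: theta_XE_def theta_EF_def capital_share_def alpha_F_def)
  have "1 - gamma_share e = PR e / (PR e + offset e)"
    using pos by (simp add: gamma_share_def field_simps)
  then show "theta_XE e * theta_ER e * theta_RK e
      = capital_share * (1 - gamma_share e) * alpha_R e"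
    using levels_pos pos
    by (simp add: theta_XE_def theta_ER_def theta_RK_def capital_share_def alpha_R_def)
qed

section \<open>Closed form of the solution\<close>

lemma numeraire_gap: "- theta_XK e * x / theta_XE e - x = - x / theta_XE e"
  unfolding shares_sum using shares_pos(5) by (simp add: field_simps)

text \<open>The final good being the numeraire, a rise \<open>w\<close> in the cost of capital forces the
  renewable energy price to change by \<open>- kappa * w\<close>.\<close>

definition kappa :: real where
  "kappa = (theta_XK e / theta_XE e + theta_EF e) / theta_ER e"

text \<open>Response of \<open>hKR\<close> to \<open>w\<close> under capital market clearing. The
  numerator is the capital released by substitution; the denominator adds to \<open>alpha_R\<close>
  the capital the other sectors absorb as they expand along with \<open>hR\<close>.\<close>

definition mu :: real where
  "mu = (alpha_X e * (theta_EF e * sigma_E * (1 + kappa) + sigma_X / theta_XE e)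
          + alpha_F e * sigma_E * (1 + kappa))
        / (alpha_R e + (alpha_X e + alpha_F e) * theta_RK e)"

definition w :: real where
  "w = gamma_share e * hs
       / (1 + (1 - gamma_share e) * kappa + theta_RQ e * mu / sigma_R)"

lemma kappa_pos: "kappa > 0"
  using shares_pos by (simp add: kappa_def add_pos_pos)

text \<open>Each positive elasticity contributes a positive term to the numerator, which would
  vanish if both were zero.\<close>

lemma mu_pos: "mu > 0"
proof -
  have "sigma_X > 0 \<or> sigma_E > 0"
    using sigma_X sigma_E sigma_XE by linarith
  then have "alpha_X e * (theta_EF e * sigma_E * (1 + kappa) + sigma_X / theta_XE e)
          + alpha_F e * sigma_E * (1 + kappa) > 0"
  proof
    assume "sigma_X > 0"
    then show ?thesis
      using shares_pos kappa_pos sigma_E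
      by (intro add_pos_nonneg mult_pos_pos add_nonneg_pos) auto
  next
    assume "sigma_E > 0"
    then show ?thesis
      using shares_pos kappa_pos sigma_X
      by (intro add_nonneg_pos mult_pos_pos mult_nonneg_nonneg add_nonneg_nonneg) auto
  qed
  then show ?thesis
    using shares_pos by (simp add: mu_def add_pos_pos)
qed

lemma renewable_cost_coeff_pos:
  "1 + (1 - gamma_share e) * kappa + theta_RQ e * mu / sigma_R > 0"
  using shares_pos kappa_pos mu_pos sigma_R by (simp add: add_pos_pos)

lemma w_pos: "w > 0"
  using renewable_cost_coeff_pos shares_pos hs by (simp add: w_def)

text \<open>The witness \<open>\<tau>\<close> comes from the government budget, which alone
  determines how \<open>w\<close> splits into tax and net price of capital.\<close>

definition solution :: changes where
  "solution =
    (let r = theta_RK e * mu * w; f = r - sigma_E * (1 + kappa) * w;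
         en = r - theta_EF e * sigma_E * (1 + kappa) * w; kx = en - sigma_X * w / theta_XE e;
         \<tau> = (hs + r - w) / (psi_ratio e - 1)
     in \<lparr> hKX = kx, hKR = mu * w, hKF = f,
          hX = theta_XK e * kx + theta_XE e * en, hE = en, hF = f, hR = r,
          hPK = w - \<tau>, hPX = 0, hPE = - theta_XK e * w / theta_XE e, hPF = w,
          hPR = - kappa * w, hPQ = w + mu * w / sigma_R, ht = \<tau> \<rparr>)"

lemma kappa_eq: "theta_ER e * kappa = theta_XK e / theta_XE e + theta_EF e"
  using shares_pos by (simp add: kappa_def)

lemma mu_eq:
  "mu * (alpha_R e + (alpha_X e + alpha_F e) * theta_RK e)
     = alpha_X e * (theta_EF e * sigma_E * (1 + kappa) + sigma_X / theta_XE e)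
       + alpha_F e * sigma_E * (1 + kappa)"
proof -
  have "alpha_R e + (alpha_X e + alpha_F e) * theta_RK e > 0"
    using shares_pos by (simp add: add_pos_pos)
  then show ?thesis by (simp add: mu_def)
qed

lemma w_eq:
  "w * (1 + (1 - gamma_share e) * kappa + theta_RQ e * (mu / sigma_R)) = gamma_share e * hs"
  using renewable_cost_coeff_pos by (simp add: w_def)

lemma loglinear_solution_solution:
  "loglinear_solution e sigma_X sigma_E sigma_R hs solution"
proof -
  \<comment> \<open>Naming the quotients \<open>g\<close>, \<open>m\<close> and
    \<open>\<tau>\<close> leaves polynomial identities to check.\<close>
  define g where "g = 1 / theta_XE e"
  have g: "x / theta_XE e = x * g" for x
    by (simp add: g_def)
  define m where "m = mu / sigma_R"
  have m: "mu * w / sigma_R = m * w"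
    by (simp add: m_def)
  define \<tau> where "\<tau> = (hs + theta_RK e * mu * w - w) / (psi_ratio e - 1)"
  have \<tau>: "psi_ratio e * \<tau> = \<tau> + (hs + theta_RK e * mu * w - w)"
    using shares_pos(12) by (simp add: \<tau>_def field_simps)
  note k = kappa_eq[unfolded g]
  note mu = mu_eq[unfolded g]
  note w = w_eq[folded m_def]
  have capital: "0 = alpha_X e * hKX solution + alpha_R e * hKR solution + alpha_F e * hKF solution"
    \<comment> \<open>Market clearing is the identity characterizing \<open>mu\<close>, scaled by
      \<open>w\<close>.\<close>
    using arg_cong[OF mu, of "\<lambda>x. x * w"]
    by (simp add: solution_def Let_def g algebra_simps)
  have final_cost: "hPX solution + hX solution = theta_XK e * (ht solution + hPK solution + hKX solution)
      + theta_XE e * (hPE solution + hE solution)"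
    using shares_pos(5) by (simp add: solution_def Let_def algebra_simps)
  have final_subst: "hKX solution - hE solution
      = sigma_X * (hPE solution - ht solution - hPK solution)"
  proof -
    have "hPE solution - ht solution - hPK solution = - w / theta_XE e"
      using numeraire_gap[of w] by (simp add: solution_def Let_def)
    then show ?thesis by (simp add: solution_def Let_def)
  qed
  have energy_split: "x = theta_EF e * x + theta_ER e * x" for x
    unfolding shares_sum(2) by (simp add: algebra_simps)
  have energy_cost: "hPE solution + hE solution
      = theta_EF e * (hPF solution + hF solution) + theta_ER e * (hPR solution + hR solution)"
    "hE solution = theta_EF e * hF solution + theta_ER e * hR solution"
    using arg_cong[OF k, of "\<lambda>x. x * w"] energy_split[of "theta_RK e * (mu * w)"]
    by (simp_all add: solution_def Let_def g algebra_simps)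
  have renewable_cost: "(1 - gamma_share e) * hPR solution + gamma_share e * hs + hR solution
       = theta_RK e * (ht solution + hPK solution + hKR solution) + theta_RQ e * hPQ solution"
    using w unfolding shares_sum(3) by (simp add: solution_def Let_def m algebra_simps)
  have budget: "hs + hR solution = psi_ratio e * ht solution + hPK solution"
    using \<tau> by (simp add: solution_def Let_def flip: \<tau>_def)
  show ?thesis
    unfolding loglinear_solution_def
    using capital final_cost final_subst energy_cost renewable_cost budget sigma_R
    by (simp add: solution_def Let_def algebra_simps)
qed

section \<open>Uniqueness\<close>

text \<open>Outside the budget equation, \<open>ht\<close> and \<open>hPK\<close> occur only through
  their sum \<open>v\<close>. The other equations therefore determine \<open>v\<close> and all
  remaining unknowns; the budget then separates the two.\<close>

lemma loglinear_solution_unique: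
  assumes "loglinear_solution e sigma_X sigma_E sigma_R hs h"
  shows "h = solution"
proof -
  define v where "v = ht h + hPK h"
  have capital: "0 = alpha_X e * hKX h + alpha_R e * hKR h + alpha_F e * hKF h"
    and X: "hX h = theta_XK e * hKX h + theta_XE e * hE h"
    and PX: "hPX h = 0"
    and final_cost: "hPX h + hX h = theta_XK e * (v + hKX h) + theta_XE e * (hPE h + hE h)"
    and final_subst: "hKX h - hE h = sigma_X * (hPE h - v)"
    and E: "hE h = theta_EF e * hF h + theta_ER e * hR h"
    and energy_cost: "hPE h + hE h = theta_EF e * (hPF h + hF h) + theta_ER e * (hPR h + hR h)"
    and energy_subst: "hR h - hF h = sigma_E * (hPF h - hPR h)"
    and R: "hR h = theta_RK e * hKR h"
    and renewable_cost: "(1 - gamma_share e) * hPR h + gamma_share e * hs + hR h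
       = theta_RK e * (v + hKR h) + theta_RQ e * hPQ h"
    and renewable_subst: "hKR h = sigma_R * (hPQ h - v)"
    and F: "hF h = hKF h"
    and PF: "hPF h = v"
    and budget: "hs + hR h = psi_ratio e * ht h + hPK h"
    using assms unfolding loglinear_solution_def v_def by (auto simp: algebra_simps)
  \<comment> \<open>Subtracting the production equation from zero profit removes all
    quantities.\<close>
  have "theta_XE e * hPE h = - theta_XK e * v"
    using final_cost X PX by (simp add: algebra_simps)
  then have PE: "hPE h = - theta_XK e * v / theta_XE e"
    using shares_pos(5) by (simp add: field_simps)
  have PE_gap: "hPE h - v = - v / theta_XE e"
    using PE numeraire_gap by simp
  have "theta_ER e * hPR h = hPE h - theta_EF e * v"
    using energy_cost E PF by (simp add: algebra_simps)
  also have "\<dots> = theta_ER e * (- kappa * v)"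
    using arg_cong[OF kappa_eq, of "\<lambda>x. x * v"] PE by (simp add: algebra_simps)
  finally have PR: "hPR h = - kappa * v"
    using shares_pos(7) by (metis less_irrefl mult_left_cancel)
  have F': "hF h = hR h - sigma_E * (1 + kappa) * v"
    using energy_subst PF PR by (simp add: algebra_simps)
  have E': "hE h = hR h - theta_EF e * sigma_E * (1 + kappa) * v"
    using E F' shares_sum(2) by (simp add: algebra_simps)
  have KX': "hKX h = hE h - sigma_X * v / theta_XE e"
    using final_subst PE_gap by simp
  \<comment> \<open>Coefficient of \<open>hKR h\<close> in market clearing once the other capital
    uses are eliminated.\<close>
  define d where "d = alpha_R e + (alpha_X e + alpha_F e) * theta_RK e"
  have d: "d > 0"
    using shares_pos by (simp add: d_def add_pos_pos)
  have "d * hKR h = d * (mu * v)"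
    using capital arg_cong[OF mu_eq, of "\<lambda>x. x * v"] F
    unfolding KX' E' F'[unfolded F] R d_def by (simp add: algebra_simps)
  then have KR: "hKR h = mu * v"
    using d by simp
  have PQ: "hPQ h = v + mu * v / sigma_R"
    using renewable_subst KR sigma_R by (simp add: field_simps)
  \<comment> \<open>The quantity terms cancel since \<open>hR h = theta_RK e * hKR h\<close>,
    leaving one equation in \<open>v\<close>.\<close>
  have "v * (1 + (1 - gamma_share e) * kappa + theta_RQ e * mu / sigma_R) = gamma_share e * hs"
    using renewable_cost unfolding R PR KR PQ shares_sum(3) by (simp add: algebra_simps)
  then have v: "v = w"
    using renewable_cost_coeff_pos by (simp add: w_def field_simps)
  have "(psi_ratio e - 1) * ht h = hs + hR h - v"
    using budget by (simp add: v_def algebra_simps)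
  then have t: "ht h = (hs + theta_RK e * mu * w - w) / (psi_ratio e - 1)"
    using shares_pos(12) R KR v by (simp add: field_simps)
  have PK: "hPK h = w - ht h"
    using v by (simp add: v_def)
  show ?thesis
    by (rule changes.equality)
      (simp_all add: solution_def Let_def X PX PE PF PR PQ PK t KR KX' E' F' R v mult.assoc flip: F)
qed

section \<open>Sign of the output change\<close>

lemma final_good_change:
  assumes "loglinear_solution e sigma_X sigma_E sigma_R hs h"
  shows "hX h = - capital_share * gamma_share e * alpha_R e * hKR h"
proof -
  have capital: "0 = alpha_X e * hKX h + alpha_R e * hKR h + alpha_F e * hKF h"
    and X: "hX h = theta_XK e * hKX h
      + theta_XE e * (theta_EF e * hKF h + theta_ER e * (theta_RK e * hKR h))"
    using assms unfolding loglinear_solution_def by auto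
  have "hX h = theta_XK e * hKX h + (theta_XE e * theta_EF e) * hKF h
      + (theta_XE e * theta_ER e * theta_RK e) * hKR h"
    using X by (simp add: algebra_simps)
  \<comment> \<open>The bracket vanishes by market clearing; only the offset wedge remains.\<close>
  also have "\<dots> = capital_share * (alpha_X e * hKX h + alpha_R e * hKR h + alpha_F e * hKF h)
      - capital_share * gamma_share e * alpha_R e * hKR h"
    unfolding final_good_shares by (simp add: algebra_simps)
  finally show ?thesis
    by (simp flip: capital)
qed

lemma final_good_falls:
  assumes "loglinear_solution e sigma_X sigma_E sigma_R hs h"
  shows "hX h < 0"
proof -
  have "hKR h = mu * w"
    using loglinear_solution_unique[OF assms] by (simp add: solution_def Let_def)
  then show ?thesis
    using final_good_change[OF assms] capital_share_pos shares_pos mu_pos w_pos by simp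
qed

end

theorem proposition2:
  fixes e :: levels and sigma_X sigma_E sigma_R hs :: real
  assumes "initial_equilibrium e"
    and "sigma_X \<ge> 0" and "sigma_E \<ge> 0" and "sigma_R \<ge> 0"
    and "sigma_R \<noteq> 0"
    and "\<not> (sigma_X = 0 \<and> sigma_E = 0)"
    and "hs > 0"
  shows "(\<exists>!h. loglinear_solution e sigma_X sigma_E sigma_R hs h) \<and>
         (\<forall>h. loglinear_solution e sigma_X sigma_E sigma_R hs h \<longrightarrow> hX h < 0)"
proof -
  interpret taxed_economy e sigma_X sigma_E sigma_R hs
    using assms by unfold_locales auto
  show ?thesis
    using loglinear_solution_solution loglinear_solution_unique final_good_falls by blast
qed

end
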